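(* Let $(A,C,\psi)$ be an entwining structure over a field $k$. Then $(\mathscr C^\bullet_\lambda(A,C,\psi),\delta^\bullet)$ is a subcomplex of the Hochschild complex $(\mathscr C^\bullet(A,C,\psi),\delta^\bullet)$ of $(A,C,\psi)$; that is, $\delta^n(\mathscr C^n_\lambda(A,C,\psi))\subseteq \mathscr C^{n+1}_\lambda(A,C,\psi)$ for all $n\ge 0$.
   Context: Let $k$ be a field; $\otimes$ and $Hom$ are over $k$. An entwining structure $(A,C,\psi)$ over $k$ consists of a unital associative $k$-algebra $A$ with product $\theta$, a counital coassociative $k$-coalgebra $C$ (coproduct $\Delta$, counit $\varepsilon$), and a $k$-linear map $\psi:C\otimes A\to A\otimes C$, written $\psi(c\otimes a)=a_\psi\otimes c^\psi$ with summation suppressed, such that: (i) $\psi\circ(id_C\otimes\theta)=(\theta\otimes id_C)\circ(id_A\otimes\psi)\circ(\psi\otimes id_A)$; (ii) $(id_A\otimes\Delta)\circ\psi=(\psi\otimes id_C)\circ(id_C\otimes\psi)\circ(\Delta\otimes id_A)$; (iii) $a_\psi\,\varepsilon(c^\psi)=\varepsilon(c)a$; (iv) $1_\psi\otimes c^\psi=1\otimes c$, for all $a\in A$, $c\in C$. The Hochschild complex of $(A,C,\psi)$ is $\mathscr C^n(A,C,\psi)=Hom(C\otimes A^{\otimes n+1},k)$, $n\ge0$, with differential $\delta^n:\mathscr C^n\to\mathscr C^{n+1}$, $$\delta^n(g)(c,a_1,\dots,a_{n+2})=g(c^\psi,a_2,\dots,a_{n+1},a_{n+2}a_{1\psi})+\sum_{i=1}^{n+1}(-1)^i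 g(c,a_1,\dots,a_ia_{i+1},\dots,a_{n+2}),$$ where $(c,a_1,\dots,a_m)$ stands for $c\otimes a_1\otimes\cdots\otimes a_m$. $\mathscr C^n_\lambda(A,C,\psi)\subseteq\mathscr C^n(A,C,\psi)$ is the subspace of all $g$ satisfying $g(c,a_1,\dots,a_{n+1})=(-1)^n g(c^\psi,a_2,\dots,a_{n+1},a_{1\psi})$ for all $c\in C$, $a_i\in A$. *)

theory Defs
  imports
    Complex_Main
    "HOL-Library.Poly_Mapping"
    "HOL-Library.Function_Algebras"
begin

section \<open>Tensor products as quotients of free vector spaces\<close>

text \<open>
  The free vector space on the elements of a type \<open>'x\<close> is \<open>'x \<Rightarrow>\<^sub>0 'k\<close>. A tensor product is the
  quotient of the free vector space on tuples by the span of the multilinearity relations; its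
  elements are the cosets of that subspace. The tensor products live on explicit sets of cosets
  because the relations depend on the scalar multiplications, which are not part of the types.
\<close>

definition gen :: "'x \<Rightarrow> 'x \<Rightarrow>\<^sub>0 'k::field" where
  "gen x = Poly_Mapping.single x 1"

definition fscale :: "'k::field \<Rightarrow> ('x \<Rightarrow>\<^sub>0 'k) \<Rightarrow> ('x \<Rightarrow>\<^sub>0 'k)" where
  "fscale r p = Poly_Mapping.map ((*) r) p"

lemma vector_space_fscale: "vector_space (fscale :: 'k::field \<Rightarrow> ('x \<Rightarrow>\<^sub>0 'k) \<Rightarrow> _)"
proof -
  have lookup: "Poly_Mapping.lookup (fscale r p) x = r * Poly_Mapping.lookup p x"
    for r :: 'k and p :: "'x \<Rightarrow>\<^sub>0 'k" and x
    by (simp add: fscale_def Poly_Mapping.map.rep_eq when_def)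
  show ?thesis
    by unfold_locales
      (auto intro!: poly_mapping_eqI simp: lookup lookup_add algebra_simps)
qed

definition coset :: "('x \<Rightarrow>\<^sub>0 'k::field) set \<Rightarrow> ('x \<Rightarrow>\<^sub>0 'k) \<Rightarrow> ('x \<Rightarrow>\<^sub>0 'k) set" where
  "coset N p = {q. q - p \<in> N}"

definition quot :: "'x set \<Rightarrow> ('x \<Rightarrow>\<^sub>0 'k::field) set \<Rightarrow> ('x \<Rightarrow>\<^sub>0 'k) set set" where
  "quot S N = coset N ` {p. Poly_Mapping.keys p \<subseteq> S}"

definition rep :: "('x \<Rightarrow>\<^sub>0 'k::field) set \<Rightarrow> ('x \<Rightarrow>\<^sub>0 'k)" where
  "rep X = (SOME p. p \<in> X)"

definition qadd :: "('x \<Rightarrow>\<^sub>0 'k::field) set \<Rightarrow> ('x \<Rightarrow>\<^sub>0 'k) set \<Rightarrow> ('x \<Rightarrow>\<^sub>0 'k) set \<Rightarrow> ('x \<Rightarrow>\<^sub>0 'k) set" where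
  "qadd N X Y = coset N (rep X + rep Y)"

definition qscale :: "('x \<Rightarrow>\<^sub>0 'k::field) set \<Rightarrow> 'k \<Rightarrow> ('x \<Rightarrow>\<^sub>0 'k) set \<Rightarrow> ('x \<Rightarrow>\<^sub>0 'k) set" where
  "qscale N r X = coset N (fscale r (rep X))"

text \<open>
  If \<open>f\<close>, given on generators, respects the relations \<open>N\<close>, then \<open>lift s f\<close> is the induced linear
  map on the quotient by \<open>N\<close> with values in the vector space with scalar multiplication \<open>s\<close>, and
  \<open>qlift M f\<close> the induced linear map with values in the quotient by \<open>M\<close>. In both cases \<open>\<Sum>\<^sub>i v\<^sub>i \<otimes> w\<^sub>i\<close>
  is sent to \<open>\<Sum>\<^sub>i f (v\<^sub>i, w\<^sub>i)\<close>, whichever expression as a sum of pure tensors is chosen.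
\<close>

definition lift :: "('k::field \<Rightarrow> 'u \<Rightarrow> 'u::ab_group_add) \<Rightarrow> ('x \<Rightarrow> 'u) \<Rightarrow> ('x \<Rightarrow>\<^sub>0 'k) set \<Rightarrow> 'u" where
  "lift s f X = (\<Sum>x\<in>Poly_Mapping.keys (rep X). s (Poly_Mapping.lookup (rep X) x) (f x))"

definition qlift :: "('y \<Rightarrow>\<^sub>0 'k::field) set \<Rightarrow> ('x \<Rightarrow> ('y \<Rightarrow>\<^sub>0 'k) set) \<Rightarrow> ('x \<Rightarrow>\<^sub>0 'k) set \<Rightarrow> ('y \<Rightarrow>\<^sub>0 'k) set" where
  "qlift M f X = coset M (lift fscale (\<lambda>x. rep (f x)) X)"

text \<open>Linearity in one tensor factor; \<open>i\<close> inserts a vector into this factor of a fixed tuple.\<close>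

definition slot_rels :: "('k::field \<Rightarrow> 'v \<Rightarrow> 'v::ab_group_add) \<Rightarrow> ('v \<Rightarrow> 'x) \<Rightarrow> ('x \<Rightarrow>\<^sub>0 'k) set" where
  "slot_rels s i =
     {gen (i (v + v')) - gen (i v) - gen (i v') |v v'. True} \<union>
     {gen (i (s r v)) - fscale r (gen (i v)) |r v. True}"

definition rel2 :: "('k::field \<Rightarrow> 'v \<Rightarrow> 'v::ab_group_add) \<Rightarrow> ('k \<Rightarrow> 'w \<Rightarrow> 'w::ab_group_add)
    \<Rightarrow> ('v \<times> 'w \<Rightarrow>\<^sub>0 'k) set" where
  "rel2 sV sW = module.span fscale
     ((\<Union>w. slot_rels sV (\<lambda>v. (v, w))) \<union> (\<Union>v. slot_rels sW (\<lambda>w. (v, w))))"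

definition rel3 :: "('k::field \<Rightarrow> 'u \<Rightarrow> 'u::ab_group_add) \<Rightarrow> ('k \<Rightarrow> 'v \<Rightarrow> 'v::ab_group_add)
    \<Rightarrow> ('k \<Rightarrow> 'w \<Rightarrow> 'w::ab_group_add) \<Rightarrow> ('u \<times> 'v \<times> 'w \<Rightarrow>\<^sub>0 'k) set" where
  "rel3 sU sV sW = module.span fscale
     ((\<Union>v w. slot_rels sU (\<lambda>u. (u, v, w))) \<union>
      (\<Union>u w. slot_rels sV (\<lambda>v. (u, v, w))) \<union>
      (\<Union>u v. slot_rels sW (\<lambda>w. (u, v, w))))"

definition tensor2 :: "('k::field \<Rightarrow> 'v \<Rightarrow> 'v::ab_group_add) \<Rightarrow> ('k \<Rightarrow> 'w \<Rightarrow> 'w::ab_group_add)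
    \<Rightarrow> ('v \<times> 'w \<Rightarrow>\<^sub>0 'k) set set" where
  "tensor2 sV sW = quot UNIV (rel2 sV sW)"

definition tensor3 :: "('k::field \<Rightarrow> 'u \<Rightarrow> 'u::ab_group_add) \<Rightarrow> ('k \<Rightarrow> 'v \<Rightarrow> 'v::ab_group_add)
    \<Rightarrow> ('k \<Rightarrow> 'w \<Rightarrow> 'w::ab_group_add) \<Rightarrow> ('u \<times> 'v \<times> 'w \<Rightarrow>\<^sub>0 'k) set set" where
  "tensor3 sU sV sW = quot UNIV (rel3 sU sV sW)"

definition ten2 :: "('k::field \<Rightarrow> 'v \<Rightarrow> 'v::ab_group_add) \<Rightarrow> ('k \<Rightarrow> 'w \<Rightarrow> 'w::ab_group_add)
    \<Rightarrow> 'v \<Rightarrow> 'w \<Rightarrow> ('v \<times> 'w \<Rightarrow>\<^sub>0 'k) set" where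
  "ten2 sV sW v w = coset (rel2 sV sW) (gen (v, w))"

definition ten3 :: "('k::field \<Rightarrow> 'u \<Rightarrow> 'u::ab_group_add) \<Rightarrow> ('k \<Rightarrow> 'v \<Rightarrow> 'v::ab_group_add)
    \<Rightarrow> ('k \<Rightarrow> 'w \<Rightarrow> 'w::ab_group_add) \<Rightarrow> 'u \<Rightarrow> 'v \<Rightarrow> 'w \<Rightarrow> ('u \<times> 'v \<times> 'w \<Rightarrow>\<^sub>0 'k) set" where
  "ten3 sU sV sW u v w = coset (rel3 sU sV sW) (gen (u, v, w))"

text \<open>For \<open>f : V \<otimes> W \<rightarrow> V' \<otimes> W'\<close>, the maps \<open>f \<otimes> id\<close> and \<open>id \<otimes> f\<close> with a third space \<open>Z\<close>.\<close>

definition tensor_id where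
  "tensor_id sV sW sV' sW' sZ f =
     qlift (rel3 sV' sW' sZ) (\<lambda>(v, w, z).
       qlift (rel3 sV' sW' sZ) (\<lambda>(v', w'). ten3 sV' sW' sZ v' w' z) (f (ten2 sV sW v w)))"

definition id_tensor where
  "id_tensor sZ sV sW sV' sW' f =
     qlift (rel3 sZ sV' sW') (\<lambda>(z, v, w).
       qlift (rel3 sZ sV' sW') (\<lambda>(v', w'). ten3 sZ sV' sW' z v' w') (f (ten2 sV sW v w)))"

text \<open>For \<open>D : C \<rightarrow> C \<otimes> C\<close>, the maps \<open>D \<otimes> id\<close> and \<open>id \<otimes> D\<close> with a space \<open>Z\<close>.\<close>

definition comult_id where
  "comult_id sC sZ D =
     qlift (rel3 sC sC sZ) (\<lambda>(c, z).
       qlift (rel3 sC sC sZ) (\<lambda>(c1, c2). ten3 sC sC sZ c1 c2 z) (D c))"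

definition id_comult where
  "id_comult sZ sC D =
     qlift (rel3 sZ sC sC) (\<lambda>(z, c).
       qlift (rel3 sZ sC sC) (\<lambda>(c1, c2). ten3 sZ sC sC z c1 c2) (D c))"

definition mult_id where
  "mult_id sA sZ = qlift (rel2 sA sZ) (\<lambda>(a, b, z). ten2 sA sZ (a * b) z)"

definition id_mult where
  "id_mult sZ sA = qlift (rel2 sZ sA) (\<lambda>(z, a, b). ten2 sZ sA z (a * b))"


section \<open>Entwining structures\<close>

text \<open>The sort \<open>{ring, monoid_mult}\<close>, unlike \<open>ring_1\<close>, does not exclude the zero algebra.\<close>

locale unital_algebra = vector_space scaleA
  for scaleA :: "'k::field \<Rightarrow> 'a \<Rightarrow> 'a::{ring, monoid_mult}" +
  assumes scale_mult_left: "\<And>r x y. scaleA r x * y = scaleA r (x * y)"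
    and scale_mult_right: "\<And>r x y. x * scaleA r y = scaleA r (x * y)"

locale coalgebra = vector_space scaleC
  for scaleC :: "'k::field \<Rightarrow> 'c \<Rightarrow> 'c::ab_group_add"
    and \<Delta> :: "'c \<Rightarrow> ('c \<times> 'c \<Rightarrow>\<^sub>0 'k) set"
    and \<epsilon> :: "'c \<Rightarrow> 'k" +
  assumes comult_tensor: "\<And>c. \<Delta> c \<in> tensor2 scaleC scaleC"
    and comult_add: "\<And>c d. \<Delta> (c + d) = qadd (rel2 scaleC scaleC) (\<Delta> c) (\<Delta> d)"
    and comult_scale: "\<And>r c. \<Delta> (scaleC r c) = qscale (rel2 scaleC scaleC) r (\<Delta> c)"
    and counit_linear: "Vector_Spaces.linear scaleC (*) \<epsilon>"
    and coassoc: "\<And>c. comult_id scaleC scaleC \<Delta> (\<Delta> c) = id_comult scaleC scaleC \<Delta> (\<Delta> c)"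
    and counit_left: "\<And>c. lift scaleC (\<lambda>(c1, c2). scaleC (\<epsilon> c1) c2) (\<Delta> c) = c"
    and counit_right: "\<And>c. lift scaleC (\<lambda>(c1, c2). scaleC (\<epsilon> c2) c1) (\<Delta> c) = c"

locale entwining_structure =
  alg: unital_algebra scaleA + coalg: coalgebra scaleC \<Delta> \<epsilon>
  for scaleA :: "'k::field \<Rightarrow> 'a \<Rightarrow> 'a::{ring, monoid_mult}"
    and scaleC :: "'k \<Rightarrow> 'c \<Rightarrow> 'c::ab_group_add"
    and \<Delta> :: "'c \<Rightarrow> ('c \<times> 'c \<Rightarrow>\<^sub>0 'k) set"
    and \<epsilon> :: "'c \<Rightarrow> 'k" +
  fixes \<psi> :: "('c \<times> 'a \<Rightarrow>\<^sub>0 'k) set \<Rightarrow> ('a \<times> 'c \<Rightarrow>\<^sub>0 'k) set"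
  assumes psi_tensor: "\<And>X. X \<in> tensor2 scaleC scaleA \<Longrightarrow> \<psi> X \<in> tensor2 scaleA scaleC"
    and psi_add: "\<And>X Y. \<lbrakk>X \<in> tensor2 scaleC scaleA; Y \<in> tensor2 scaleC scaleA\<rbrakk> \<Longrightarrow>
      \<psi> (qadd (rel2 scaleC scaleA) X Y) = qadd (rel2 scaleA scaleC) (\<psi> X) (\<psi> Y)"
    and psi_scale: "\<And>r X. X \<in> tensor2 scaleC scaleA \<Longrightarrow>
      \<psi> (qscale (rel2 scaleC scaleA) r X) = qscale (rel2 scaleA scaleC) r (\<psi> X)"
    and psi_mult: "\<And>X. X \<in> tensor3 scaleC scaleA scaleA \<Longrightarrow>
      \<psi> (id_mult scaleC scaleA X) =
      mult_id scaleA scaleC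
        (id_tensor scaleA scaleC scaleA scaleA scaleC \<psi>
          (tensor_id scaleC scaleA scaleA scaleC scaleA \<psi> X))"
    and psi_comult: "\<And>X. X \<in> tensor2 scaleC scaleA \<Longrightarrow>
      id_comult scaleA scaleC \<Delta> (\<psi> X) =
      tensor_id scaleC scaleA scaleA scaleC scaleC \<psi>
        (id_tensor scaleC scaleC scaleA scaleA scaleC \<psi>
          (comult_id scaleC scaleA \<Delta> X))"
    and psi_counit: "\<And>c a. lift scaleA (\<lambda>(a', c'). scaleA (\<epsilon> c') a') (\<psi> (ten2 scaleC scaleA c a)) =
      scaleA (\<epsilon> c) a"
    and psi_unit: "\<And>c. \<psi> (ten2 scaleC scaleA c 1) = ten2 scaleA scaleC 1 c"


section \<open>The Hochschild complex\<close>

text \<open>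
  \<open>hoch_tensor scaleA scaleC m\<close> is \<open>C \<otimes> A\<^sup>\<otimes>\<^sup>m\<close>. Generators are pairs of an element of \<open>C\<close> and a list of
  exactly \<open>m\<close> elements of \<open>A\<close>.
\<close>

definition hoch_rel :: "('k::field \<Rightarrow> 'a \<Rightarrow> 'a::ab_group_add) \<Rightarrow> ('k \<Rightarrow> 'c \<Rightarrow> 'c::ab_group_add)
    \<Rightarrow> nat \<Rightarrow> ('c \<times> 'a list \<Rightarrow>\<^sub>0 'k) set" where
  "hoch_rel scaleA scaleC m = module.span fscale
     ((\<Union>as\<in>{as. length as = m}. slot_rels scaleC (\<lambda>c. (c, as))) \<union>
      (\<Union>c. \<Union>as\<in>{as. length as = m}. \<Union>j<m. slot_rels scaleA (\<lambda>a. (c, as[j := a]))))"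

definition hoch_tensor :: "('k::field \<Rightarrow> 'a \<Rightarrow> 'a::ab_group_add) \<Rightarrow> ('k \<Rightarrow> 'c \<Rightarrow> 'c::ab_group_add)
    \<Rightarrow> nat \<Rightarrow> ('c \<times> 'a list \<Rightarrow>\<^sub>0 'k) set set" where
  "hoch_tensor scaleA scaleC m = quot {(c, as). length as = m} (hoch_rel scaleA scaleC m)"

text \<open>The pure tensor \<open>(c, a\<^sub>1, \<dots>, a\<^sub>m) = c \<otimes> a\<^sub>1 \<otimes> \<dots> \<otimes> a\<^sub>m\<close>.\<close>

definition hten :: "('k::field \<Rightarrow> 'a \<Rightarrow> 'a::ab_group_add) \<Rightarrow> ('k \<Rightarrow> 'c \<Rightarrow> 'c::ab_group_add)
    \<Rightarrow> 'c \<Rightarrow> 'a list \<Rightarrow> ('c \<times> 'a list \<Rightarrow>\<^sub>0 'k) set" where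
  "hten scaleA scaleC c as = coset (hoch_rel scaleA scaleC (length as)) (gen (c, as))"

text \<open>
  \<open>Hom(C \<otimes> A\<^sup>\<otimes>\<^sup>n\<^sup>+\<^sup>1, k)\<close>. Setting functionals to zero outside the tensor product makes them
  determined by their values on it.
\<close>

definition hoch_cochains :: "('k::field \<Rightarrow> 'a \<Rightarrow> 'a::ab_group_add) \<Rightarrow> ('k \<Rightarrow> 'c \<Rightarrow> 'c::ab_group_add)
    \<Rightarrow> nat \<Rightarrow> (('c \<times> 'a list \<Rightarrow>\<^sub>0 'k) set \<Rightarrow> 'k) set" where
  "hoch_cochains scaleA scaleC n = {g.
     (\<forall>X\<in>hoch_tensor scaleA scaleC (n + 1). \<forall>Y\<in>hoch_tensor scaleA scaleC (n + 1).
        g (qadd (hoch_rel scaleA scaleC (n + 1)) X Y) = g X + g Y) \<and>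
     (\<forall>r. \<forall>X\<in>hoch_tensor scaleA scaleC (n + 1).
        g (qscale (hoch_rel scaleA scaleC (n + 1)) r X) = r * g X) \<and>
     (\<forall>X. X \<notin> hoch_tensor scaleA scaleC (n + 1) \<longrightarrow> g X = 0)}"

text \<open>
  The value of \<open>\<delta>\<^sup>n(g)\<close> at \<open>(c, a\<^sub>1, \<dots>, a\<^sub>n\<^sub>+\<^sub>2)\<close>. Lists are indexed from 0, so \<open>a\<^sub>i\<close> is \<open>as ! (i - 1)\<close>;
  the variables \<open>a'\<close> and \<open>c'\<close> stand for the Sweedler-type components of \<open>\<psi>(c \<otimes> a\<^sub>1)\<close>.
\<close>

definition hoch_diff_pure where
  "hoch_diff_pure scaleA scaleC \<psi> n g c as =
     lift (*) (\<lambda>(a', c'). g (hten scaleA scaleC c' (butlast (tl as) @ [last as * a'])))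
       (\<psi> (ten2 scaleC scaleA c (hd as))) +
     (\<Sum>i=1..n+1. (- 1) ^ i *
        g (hten scaleA scaleC c (take (i - 1) as @ [as ! (i - 1) * as ! i] @ drop (i + 1) as)))"

definition hoch_diff :: "('k::field \<Rightarrow> 'a \<Rightarrow> 'a::{ring, monoid_mult})
    \<Rightarrow> ('k \<Rightarrow> 'c \<Rightarrow> 'c::ab_group_add) \<Rightarrow> (('c \<times> 'a \<Rightarrow>\<^sub>0 'k) set \<Rightarrow> ('a \<times> 'c \<Rightarrow>\<^sub>0 'k) set)
    \<Rightarrow> nat \<Rightarrow> (('c \<times> 'a list \<Rightarrow>\<^sub>0 'k) set \<Rightarrow> 'k) \<Rightarrow> (('c \<times> 'a list \<Rightarrow>\<^sub>0 'k) set \<Rightarrow> 'k)" where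
  "hoch_diff scaleA scaleC \<psi> n g X =
     (if X \<in> hoch_tensor scaleA scaleC (n + 2)
      then lift (*) (\<lambda>(c, as). hoch_diff_pure scaleA scaleC \<psi> n g c as) X else 0)"

definition cyclic_cochains :: "('k::field \<Rightarrow> 'a \<Rightarrow> 'a::{ring, monoid_mult})
    \<Rightarrow> ('k \<Rightarrow> 'c \<Rightarrow> 'c::ab_group_add) \<Rightarrow> (('c \<times> 'a \<Rightarrow>\<^sub>0 'k) set \<Rightarrow> ('a \<times> 'c \<Rightarrow>\<^sub>0 'k) set)
    \<Rightarrow> nat \<Rightarrow> (('c \<times> 'a list \<Rightarrow>\<^sub>0 'k) set \<Rightarrow> 'k) set" where
  "cyclic_cochains scaleA scaleC \<psi> n = {g \<in> hoch_cochains scaleA scaleC n.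
     \<forall>c as. length as = n + 1 \<longrightarrow>
       g (hten scaleA scaleC c as) =
       (- 1) ^ n * lift (*) (\<lambda>(a', c'). g (hten scaleA scaleC c' (tl as @ [a'])))
         (\<psi> (ten2 scaleC scaleA c (hd as)))}"

definition fun_scale :: "'k::field \<Rightarrow> ('x \<Rightarrow> 'k) \<Rightarrow> ('x \<Rightarrow> 'k)" where
  "fun_scale r g = (\<lambda>x. r * g x)"

end

theory Submission
  imports Defs
begin

text \<open>
  View a cochain as a multilinear function \<open>F (c, a\<^sub>0, \<dots>, a\<^sub>n)\<close>. Two kinds of operators act on such
  functions: the face \<open>d\<^sub>i\<close> precomposes with multiplication of the neighbours \<open>a\<^sub>i\<close> and \<open>a\<^sub>i\<^sub>+\<^sub>1\<close>, and the
  rotation \<open>\<tau> F (c, a\<^sub>0, \<dots>, a\<^sub>n) = F (c\<^sup>\<psi>, a\<^sub>1, \<dots>, a\<^sub>n, a\<^sub>0\<^sub>\<psi>)\<close> moves the first entry past \<open>c\<close> to the end.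
  The wrap-around term of the Hochschild differential, in which the last entry is multiplied by
  \<open>a\<^sub>0\<^sub>\<psi>\<close>, is a rotation followed by multiplication of the last two entries, so
  \<open>\<delta> F = \<tau> d\<^sub>n F + (\<Sum>i\<le>n. (- 1)\<^sup>i\<^sup>+\<^sup>1 d\<^sub>i F)\<close>, and cyclic cochains are those with \<open>F = (- 1)\<^sup>n \<tau> F\<close>.

  These operators satisfy relations of a cocyclic object. Rotating shifts all positions by one,
  hence \<open>\<tau> d\<^sub>i = d\<^sub>i\<^sub>+\<^sub>1 \<tau>\<close> for \<open>i < n\<close> (lemma \<open>cyc_face\<close>). Moving \<open>a\<^sub>0\<close> and then \<open>a\<^sub>1\<close> to the end and
  multiplying them there is the same as moving the product \<open>a\<^sub>0 a\<^sub>1\<close>: this is compatibility of \<open>\<psi>\<close>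
  with the multiplication of \<open>A\<close> and gives \<open>\<tau>\<^sup>2 d\<^sub>n = d\<^sub>0 \<tau>\<close> (lemma \<open>cyc_cyc_last_face\<close>). If \<open>F\<close> is
  cyclic, these relations turn \<open>\<tau> \<delta> F\<close> into \<open>(- 1)\<^sup>n\<^sup>+\<^sup>1 \<delta> F\<close> term by term: the wrap-around term becomes
  the term of \<open>d\<^sub>0\<close>, the term of \<open>d\<^sub>i\<close> becomes that of \<open>d\<^sub>i\<^sub>+\<^sub>1\<close>, and the term of \<open>d\<^sub>n\<close> becomes the wrap-around
  term (lemma \<open>cyclic_coboundary\<close>).

  What remains is to pass between functionals on quotients of free vector spaces and multilinear
  functions. Linear maps out of such a quotient are evaluated on chosen representatives, and the
  choice does not matter as soon as the map on generators respects the relations, that is, is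
  multilinear.
\<close>

section \<open>Linear maps on tensor products\<close>

definition linext :: "('k::field \<Rightarrow> 'u \<Rightarrow> 'u::ab_group_add) \<Rightarrow> ('x \<Rightarrow> 'u) \<Rightarrow> ('x \<Rightarrow>\<^sub>0 'k) \<Rightarrow> 'u" where
  "linext s f p = (\<Sum>x\<in>Poly_Mapping.keys p. s (Poly_Mapping.lookup p x) (f x))"

abbreviation subspace where "subspace N \<equiv> module.subspace fscale N"

interpretation free: vector_space "fscale :: 'k::field \<Rightarrow> ('x \<Rightarrow>\<^sub>0 'k) \<Rightarrow> _"
  by (rule vector_space_fscale)

lemma vector_space_mult: "vector_space ((*) :: 'k::field \<Rightarrow> 'k \<Rightarrow> 'k)"
  by unfold_locales (auto simp: algebra_simps)

lemma lift_linext: "lift s f X = linext s f (rep X)"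
  by (simp add: lift_def linext_def)

lemma lookup_fscale: "Poly_Mapping.lookup (fscale r p) x = r * Poly_Mapping.lookup p x"
  by (simp add: fscale_def Poly_Mapping.map.rep_eq when_def)

lemma keys_fscale: "Poly_Mapping.keys (fscale r p) \<subseteq> Poly_Mapping.keys p"
  by (auto simp: in_keys_iff lookup_fscale)

lemma keys_slot_rels: "p \<in> slot_rels s i \<Longrightarrow> Poly_Mapping.keys p \<subseteq> range i"
  by (auto simp: slot_rels_def gen_def split: if_splits
      dest!: subsetD[OF Poly_Mapping.keys_diff] subsetD[OF keys_fscale])

lemma linext_superset:
  assumes "vector_space s" "finite K" "Poly_Mapping.keys p \<subseteq> K"
  shows "linext s f p = (\<Sum>x\<in>K. s (Poly_Mapping.lookup p x) (f x))"
proof -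
  interpret vector_space s by fact
  show ?thesis
    unfolding linext_def using assms
    by (intro sum.mono_neutral_left) (auto simp: in_keys_iff)
qed

lemma linear_linext:
  fixes s :: "'k::field \<Rightarrow> 'u \<Rightarrow> 'u::ab_group_add" and f :: "'x \<Rightarrow> 'u"
  assumes "vector_space s"
  shows "Vector_Spaces.linear fscale s (linext s f)"
proof -
  interpret vector_space s by fact
  show ?thesis
    unfolding Vector_Spaces.linear_iff
  proof (intro conjI allI free.vector_space_axioms assms)
    fix p q :: "'x \<Rightarrow>\<^sub>0 'k" and r
    let ?K = "Poly_Mapping.keys p \<union> Poly_Mapping.keys q"
    have "Poly_Mapping.keys (p + q) \<subseteq> ?K" by (rule Poly_Mapping.keys_add)
    then show "linext s f (p + q) = linext s f p + linext s f q"
      by (simp add: linext_superset[OF assms, of ?K] lookup_add scale_left_distrib sum.distrib)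
    show "linext s f (fscale r p) = s r (linext s f p)"
      by (simp add: linext_superset[OF assms, of "Poly_Mapping.keys p"] keys_fscale lookup_fscale scale_sum_right)
  qed
qed

lemma linext_gen: "vector_space s \<Longrightarrow> linext s f (gen x) = f x"
  by (simp add: linext_def gen_def vector_space.vector_space_assms(4))

lemma rep_coset:
  assumes "subspace N"
  shows "rep (coset N p) - p \<in> N"
proof -
  have "p \<in> coset N p" using free.subspace_0[OF assms] by (simp add: coset_def)
  then have "rep (coset N p) \<in> coset N p" unfolding rep_def by (rule someI)
  then show ?thesis by (simp add: coset_def)
qed

lemma coset_eqI:
  assumes "subspace N" "p - q \<in> N"
  shows "coset N p = coset N q"
proof -
  have "r - p \<in> N \<longleftrightarrow> r - q \<in> N" for r
    using free.subspace_add[OF assms(1), of "r - p" "p - q"]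
      free.subspace_diff[OF assms(1), of "r - q" "p - q"] assms(2) by auto
  then show ?thesis by (simp add: coset_def)
qed

text \<open>
  The condition under which the function \<open>f\<close> on generators induces a linear map on the quotient by \<open>N\<close>.
\<close>

definition vanishes_on where "vanishes_on s f N \<longleftrightarrow> (\<forall>p\<in>N. linext s f p = 0)"

lemma lift_coset:
  assumes "vector_space s" "subspace N" "vanishes_on s f N"
  shows "lift s f (coset N p) = linext s f p"
proof -
  interpret Vector_Spaces.linear fscale s "linext s f" using assms(1) by (rule linear_linext)
  have "linext s f (rep (coset N p) - p) = 0"
    using rep_coset[OF assms(2)] assms(3) by (auto simp: vanishes_on_def)
  then show ?thesis by (simp add: lift_linext diff)
qed

lemma lift_qadd:
  assumes "vector_space s" "subspace N" "vanishes_on s f N"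
  shows "lift s f (qadd N X Y) = lift s f X + lift s f Y"
proof -
  interpret Vector_Spaces.linear fscale s "linext s f" using assms(1) by (rule linear_linext)
  show ?thesis unfolding qadd_def lift_coset[OF assms] by (simp add: add lift_linext)
qed

lemma lift_qscale:
  assumes "vector_space s" "subspace N" "vanishes_on s f N"
  shows "lift s f (qscale N r X) = s r (lift s f X)"
proof -
  interpret Vector_Spaces.linear fscale s "linext s f" using assms(1) by (rule linear_linext)
  show ?thesis unfolding qscale_def lift_coset[OF assms] by (simp add: scale lift_linext)
qed

text \<open>
  Both sides are evaluated at the same chosen representative of \<open>X\<close>, so composites of maps between
  tensor products can be unfolded from the outside, one map at a time.
\<close>

lemma lift_qlift:
  assumes "vector_space s" "subspace M" "vanishes_on s G M"
  shows "lift s G (qlift M f X) = lift s (\<lambda>x. lift s G (f x)) X"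
proof -
  interpret Vector_Spaces.linear fscale s "linext s G" using assms(1) by (rule linear_linext)
  show ?thesis
    unfolding qlift_def lift_coset[OF assms] unfolding lift_linext
    by (simp add: linext_def[of fscale] linext_def[of s "\<lambda>x. linext s G (rep (f x))"] sum scale)
qed

lemma linear_lift_pointwise:
  assumes "\<And>x. Vector_Spaces.linear s (*) (\<lambda>v. f v x)"
  shows "Vector_Spaces.linear s (*) (\<lambda>v. lift (*) (f v) X)"
proof -
  interpret Vector_Spaces.linear s "(*)" "\<lambda>v. f v undefined" by fact
  interpret vector_space_pair s "(*)" by unfold_locales
  show ?thesis unfolding lift_def
    by (intro linear_compose_sum linear_compose_scale_right ballI assms)
qed

lemma qadd_slot:
  assumes "subspace N" "slot_rels s i \<subseteq> N"
  shows "coset N (gen (i (v + v'))) = qadd N (coset N (gen (i v))) (coset N (gen (i v')))"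
  unfolding qadd_def
proof (rule coset_eqI[OF assms(1)])
  have "gen (i (v + v')) - gen (i v) - gen (i v') \<in> N"
    using assms(2) by (auto simp: slot_rels_def)
  from free.subspace_diff[OF assms(1) free.subspace_diff[OF assms(1) this
      rep_coset[OF assms(1), of "gen (i v)"]] rep_coset[OF assms(1), of "gen (i v')"]]
  have "(gen (i (v + v')) - gen (i v) - gen (i v')) - (rep (coset N (gen (i v))) - gen (i v))
     - (rep (coset N (gen (i v'))) - gen (i v')) \<in> N" .
  then show "gen (i (v + v')) - (rep (coset N (gen (i v))) + rep (coset N (gen (i v')))) \<in> N"
    by (simp add: algebra_simps)
qed

lemma qscale_slot:
  assumes "subspace N" "slot_rels s i \<subseteq> N"
  shows "coset N (gen (i (s r v))) = qscale N r (coset N (gen (i v)))"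
  unfolding qscale_def
proof (rule coset_eqI[OF assms(1)])
  have "gen (i (s r v)) - fscale r (gen (i v)) \<in> N"
    using assms(2) by (auto simp: slot_rels_def)
  then have "(gen (i (s r v)) - fscale r (gen (i v)))
      - fscale r (rep (coset N (gen (i v))) - gen (i v)) \<in> N"
    by (rule free.subspace_diff[OF assms(1) _ free.subspace_scale[OF assms(1) rep_coset[OF assms(1)]]])
  then show "gen (i (s r v)) - fscale r (rep (coset N (gen (i v)))) \<in> N"
    by (simp add: free.scale_right_diff_distrib)
qed

text \<open>
  The target subspace \<open>M\<close> allows functions that are multilinear only modulo \<open>M\<close>, such as chosen
  representatives of elements of another quotient.
\<close>

lemma linext_span:
  assumes "vector_space s" "module.subspace s M" "\<And>p. p \<in> R \<Longrightarrow> linext s f p \<in> M"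
    and "p \<in> module.span fscale R"
  shows "linext s f p \<in> M"
proof -
  interpret vector_space s by fact
  interpret vector_space_pair fscale s by unfold_locales
  have "module.subspace fscale (linext s f -` M)"
    using assms(1,2) by (intro linear_subspace_vimage linear_linext)
  then have "module.span fscale R \<subseteq> linext s f -` M"
    using assms(3) by (intro free.span_minimal) auto
  then show ?thesis using assms(4) by auto
qed

lemma vanishes_on_span:
  assumes "vector_space s" "\<And>p. p \<in> R \<Longrightarrow> linext s f p = 0"
  shows "vanishes_on s f (module.span fscale R)"
proof -
  interpret vector_space s by fact
  show ?thesis
    unfolding vanishes_on_def using linext_span[OF assms(1), of "{0}" R f] assms(2) by auto
qed

lemma linext_slot_rels:
  assumes "Vector_Spaces.linear sV s (\<lambda>v. f (i v))" "p \<in> slot_rels sV i"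
  shows "linext s f p = 0"
proof -
  interpret Vector_Spaces.linear sV s "\<lambda>v. f (i v)" by fact
  have s: "vector_space s" by unfold_locales
  interpret L: Vector_Spaces.linear fscale s "linext s f" by (rule linear_linext[OF s])
  show ?thesis using assms(2)
    by (auto simp: slot_rels_def L.diff L.scale linext_gen[OF s] add scale)
qed

definition bilinear2 where
  "bilinear2 sV sW f \<longleftrightarrow> (\<forall>w. Vector_Spaces.linear sV (*) (\<lambda>v. f (v, w))) \<and>
     (\<forall>v. Vector_Spaces.linear sW (*) (\<lambda>w. f (v, w)))"

definition trilinear3 where
  "trilinear3 sU sV sW f \<longleftrightarrow> (\<forall>v w. Vector_Spaces.linear sU (*) (\<lambda>u. f (u, v, w))) \<and>
     (\<forall>u w. Vector_Spaces.linear sV (*) (\<lambda>v. f (u, v, w))) \<and>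
     (\<forall>u v. Vector_Spaces.linear sW (*) (\<lambda>w. f (u, v, w)))"

lemma subspace_rel2: "subspace (rel2 sV sW)"
  and subspace_rel3: "subspace (rel3 sU sV sW)"
  and subspace_hoch_rel: "subspace (hoch_rel sA sC m)"
  by (simp_all add: rel2_def rel3_def hoch_rel_def free.subspace_span)

lemma vanishes_on_rel2: "bilinear2 sV sW f \<Longrightarrow> vanishes_on (*) f (rel2 sV sW)"
  unfolding rel2_def bilinear2_def
  by (intro vanishes_on_span vector_space_mult)
     (auto elim!: linext_slot_rels[rotated])

lemma vanishes_on_rel3: "trilinear3 sU sV sW f \<Longrightarrow> vanishes_on (*) f (rel3 sU sV sW)"
  unfolding rel3_def trilinear3_def
  by (intro vanishes_on_span vector_space_mult)
     (auto elim!: linext_slot_rels[rotated])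

lemma lift_ten2: "bilinear2 sV sW f \<Longrightarrow> lift (*) f (ten2 sV sW v w) = f (v, w)"
  unfolding ten2_def
  by (subst lift_coset[OF vector_space_mult subspace_rel2 vanishes_on_rel2])
     (auto simp: linext_gen[OF vector_space_mult])

lemma lift_ten3: "trilinear3 sU sV sW f \<Longrightarrow> lift (*) f (ten3 sU sV sW u v w) = f (u, v, w)"
  unfolding ten3_def
  by (subst lift_coset[OF vector_space_mult subspace_rel3 vanishes_on_rel3])
     (auto simp: linext_gen[OF vector_space_mult])

lemma slot_rels_rel2:
  "slot_rels sV (\<lambda>v. (v, w)) \<subseteq> rel2 sV sW" "slot_rels sW (\<lambda>w. (v, w)) \<subseteq> rel2 sV sW"
  unfolding rel2_def by (auto intro!: free.span_base)

lemma ten2_linear: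
  "ten2 sV sW (v + v') w = qadd (rel2 sV sW) (ten2 sV sW v w) (ten2 sV sW v' w)"
  "ten2 sV sW (sV r v) w = qscale (rel2 sV sW) r (ten2 sV sW v w)"
  "ten2 sV sW v (w + w') = qadd (rel2 sV sW) (ten2 sV sW v w) (ten2 sV sW v w')"
  "ten2 sV sW v (sW r w) = qscale (rel2 sV sW) r (ten2 sV sW v w)"
  unfolding ten2_def
  by (rule qadd_slot[OF subspace_rel2 slot_rels_rel2(1)]
      qscale_slot[OF subspace_rel2 slot_rels_rel2(1)]
      qadd_slot[OF subspace_rel2 slot_rels_rel2(2)]
      qscale_slot[OF subspace_rel2 slot_rels_rel2(2)])+

lemma ten2_in_tensor2: "ten2 sV sW v w \<in> tensor2 sV sW"
  by (auto simp: ten2_def tensor2_def quot_def)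

lemma ten3_in_tensor3: "ten3 sU sV sW u v w \<in> tensor3 sU sV sW"
  by (auto simp: ten3_def tensor3_def quot_def)

lemma (in unital_algebra) linear_mult:
  "Vector_Spaces.linear scaleA scaleA (\<lambda>x. a * x)" "Vector_Spaces.linear scaleA scaleA (\<lambda>x. x * a)"
  by unfold_locales (auto simp: scale_mult_left scale_mult_right distrib_left distrib_right)

text \<open>
  This equality of cosets is needed, and not just its image under linear functionals, because \<open>\<psi>\<close>
  will be applied to both sides.
\<close>

lemma (in unital_algebra) id_mult_ten3:
  "id_mult sC scaleA (ten3 sC scaleA scaleA c a b) = ten2 sC scaleA c (a * b)"
proof -
  let ?M = "rel2 sC scaleA" and ?t = "ten2 sC scaleA"
  define f where "f = (\<lambda>(z, a, b). rep (?t z (a * b)))"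
  have f: "f (z, a, b) = rep (?t z (a * b))" for z a b by (simp add: f_def)
  note sub = subspace_rel2[of sC scaleA]
  \<comment> \<open>Choosing representatives makes \<open>f\<close> trilinear only modulo \<open>?M\<close>.\<close>
  have f_gen: "f (z, a, b) - gen (z, a * b) \<in> ?M" for z a b
    unfolding f_def ten2_def by (simp add: rep_coset[OF sub])
  have rep_add: "rep X - rep Y - rep Z \<in> ?M" if "X = qadd ?M Y Z" for X Y Z
    using rep_coset[OF sub, of "rep Y + rep Z"] that by (simp add: qadd_def diff_diff_eq)
  have rep_scale: "rep X - fscale r (rep Y) \<in> ?M" if "X = qscale ?M r Y" for X Y r
    using rep_coset[OF sub, of "fscale r (rep Y)"] that by (simp add: qscale_def)
  interpret L: Vector_Spaces.linear fscale fscale "linext fscale f"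
    by (rule linear_linext[OF free.vector_space_axioms])
  have rel: "linext fscale f p \<in> ?M" if "p \<in> rel3 sC scaleA scaleA" for p
    using that unfolding rel3_def
    by (rule linext_span[OF free.vector_space_axioms sub, rotated])
      (auto simp: slot_rels_def L.diff L.scale linext_gen[OF free.vector_space_axioms] f
        distrib_left distrib_right scale_mult_left scale_mult_right
        intro!: rep_add rep_scale ten2_linear)
  have "linext fscale f (rep (ten3 sC scaleA scaleA c a b)) - f (c, a, b) \<in> ?M"
    using rel[OF rep_coset[OF subspace_rel3], of "gen (c, a, b)"]
    by (simp add: ten3_def L.diff linext_gen[OF free.vector_space_axioms])
  from free.subspace_add[OF sub this f_gen[of c a b]]
  have "linext fscale f (rep (ten3 sC scaleA scaleA c a b)) - gen (c, a * b) \<in> ?M" by simp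
  moreover have "(\<lambda>x. rep (case x of (z, a, b) \<Rightarrow> ?t z (a * b))) = f"
    by (auto simp: f_def)
  ultimately show ?thesis
    unfolding id_mult_def qlift_def lift_linext ten2_def[of _ _ c]
    by (auto intro!: coset_eqI[OF sub])
qed

section \<open>Entwining maps and multilinear functions\<close>

definition multilinear where
  "multilinear sA sC m F \<longleftrightarrow>
     (\<forall>as. length as = m \<longrightarrow> Vector_Spaces.linear sC (*) (\<lambda>c. F c as)) \<and>
     (\<forall>c as j. length as = m \<longrightarrow> j < m \<longrightarrow> Vector_Spaces.linear sA (*) (\<lambda>a. F c (as[j := a])))"

definition merge :: "nat \<Rightarrow> 'a::times list \<Rightarrow> 'a list" where
  "merge i as = take i as @ [as ! i * as ! (i + 1)] @ drop (i + 2) as"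

definition face :: "nat \<Rightarrow> ('c \<Rightarrow> 'a::times list \<Rightarrow> 'k) \<Rightarrow> 'c \<Rightarrow> 'a list \<Rightarrow> 'k" where
  "face i F c as = F c (merge i as)"

lemma length_merge: "length as = m + 1 \<Longrightarrow> i < m \<Longrightarrow> length (merge i as) = m"
  by (simp add: merge_def)

lemma nth_merge:
  assumes "length as = m + 1" "i < m" "l < m"
  shows "merge i as ! l =
    (if l < i then as ! l else if l = i then as ! i * as ! (i + 1) else as ! (l + 1))"
proof (cases "i < l")
  case True
  then obtain d where "l = Suc (i + d)" using less_imp_Suc_add by blast
  then show ?thesis using assms by (simp add: merge_def nth_append)
qed (use assms in \<open>auto simp: merge_def nth_append\<close>)

lemma merge_update:
  assumes "length as = m + 1" "i < m" "j < m + 1"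
  shows "merge i (as[j := a]) =
    (if j < i then (merge i as)[j := a]
     else if j = i then (merge i as)[i := a * as ! (i + 1)]
     else if j = i + 1 then (merge i as)[i := as ! i * a]
     else (merge i as)[j - 1 := a])"
  using assms
  by (intro nth_equalityI) (auto simp: length_merge nth_merge nth_list_update)

lemma merge_rotate:
  assumes "i + 1 < length as"
  shows "merge i (as @ [x]) = merge i as @ [x]"
  using assms by (simp add: merge_def nth_append)

context entwining_structure
begin

text \<open>
  The rotation \<open>\<tau>\<close>; the pair \<open>(a', c')\<close> runs over the components of \<open>\<psi> (c \<otimes> a)\<close> for the first entry \<open>a\<close>.
\<close>

definition cyc where
  "cyc F c as = lift (*) (\<lambda>(a', c'). F c' (tl as @ [a'])) (\<psi> (ten2 scaleC scaleA c (hd as)))"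

lemma linear_lift_psi:
  assumes "bilinear2 scaleA scaleC G"
  shows "Vector_Spaces.linear scaleC (*) (\<lambda>c. lift (*) G (\<psi> (ten2 scaleC scaleA c a)))"
    and "Vector_Spaces.linear scaleA (*) (\<lambda>a. lift (*) G (\<psi> (ten2 scaleC scaleA c a)))"
proof -
  note l = lift_qadd[OF vector_space_mult subspace_rel2 vanishes_on_rel2[OF assms]]
    lift_qscale[OF vector_space_mult subspace_rel2 vanishes_on_rel2[OF assms]]
  show "Vector_Spaces.linear scaleC (*) (\<lambda>c. lift (*) G (\<psi> (ten2 scaleC scaleA c a)))"
    unfolding Vector_Spaces.linear_iff
    by (simp add: vector_space_mult alg.vector_space_axioms coalg.vector_space_axioms
        ten2_linear psi_add psi_scale ten2_in_tensor2 l)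
  show "Vector_Spaces.linear scaleA (*) (\<lambda>a. lift (*) G (\<psi> (ten2 scaleC scaleA c a)))"
    unfolding Vector_Spaces.linear_iff
    by (simp add: vector_space_mult alg.vector_space_axioms coalg.vector_space_axioms
        ten2_linear psi_add psi_scale ten2_in_tensor2 l)
qed

text \<open>
  The compatibility of \<open>\<psi>\<close> with multiplication, evaluated on a pure tensor and tested against a
  bilinear \<open>G\<close>: in Sweedler notation, \<open>G (a\<^sub>\<psi> b\<^sub>\<phi>, c\<^sup>\<psi>\<^sup>\<phi>) = G ((a b)\<^sub>\<psi>, c\<^sup>\<psi>)\<close>.
\<close>

lemma lift_psi_mult:
  assumes G: "bilinear2 scaleA scaleC G"
  shows "lift (*) (\<lambda>(a', c'). lift (*) (\<lambda>(b', c''). G (a' * b', c''))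
            (\<psi> (ten2 scaleC scaleA c' b))) (\<psi> (ten2 scaleC scaleA c a)) =
         lift (*) G (\<psi> (ten2 scaleC scaleA c (a * b)))"
proof -
  note vs = vector_space_mult
  have comp: "Vector_Spaces.linear scaleA (*) (\<lambda>x. G (x * y, z))"
    "Vector_Spaces.linear scaleA (*) (\<lambda>x. G (y * x, z))" for y z
    using G Vector_Spaces.linear_compose[OF alg.linear_mult(1), of "(*)" "\<lambda>x. G (x, z)" y]
      Vector_Spaces.linear_compose[OF alg.linear_mult(2), of "(*)" "\<lambda>x. G (x, z)" y]
    by (auto simp: bilinear2_def o_def)
  \<comment> \<open>Pull \<open>G\<close> back along the three maps of the right-hand side of the axiom, the last one first:
      multiplication in \<open>A\<close>, then \<open>id \<otimes> \<psi>\<close>, then \<open>\<psi> \<otimes> id\<close>. Each pullback is again trilinear.\<close>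
  define H where "H = (\<lambda>(x, y, z). G (x * y, z))"
  define K where "K = (\<lambda>(x, d, y). lift (*) (\<lambda>(y', z). H (x, y', z)) (\<psi> (ten2 scaleC scaleA d y)))"
  define J where "J = (\<lambda>(d, x, y). lift (*) (\<lambda>(x', d'). K (x', d', y)) (\<psi> (ten2 scaleC scaleA d x)))"
  have H: "trilinear3 scaleA scaleA scaleC H"
    using G comp by (auto simp: trilinear3_def bilinear2_def H_def)
  have H2: "bilinear2 scaleA scaleC (\<lambda>(y', z). H (x, y', z))" for x
    using H by (auto simp: trilinear3_def bilinear2_def)
  have K: "trilinear3 scaleA scaleC scaleA K"
    using linear_lift_psi[OF H2] H
    by (auto simp: trilinear3_def K_def intro!: linear_lift_pointwise)
  have K2: "bilinear2 scaleA scaleC (\<lambda>(x', d'). K (x', d', y))" for y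
    using K by (auto simp: trilinear3_def bilinear2_def)
  have J: "trilinear3 scaleC scaleA scaleA J"
    using linear_lift_psi[OF K2] K
    by (auto simp: trilinear3_def J_def intro!: linear_lift_pointwise)
  let ?X = "ten3 scaleC scaleA scaleA c a b"
  have "lift (*) G (\<psi> (ten2 scaleC scaleA c (a * b))) = lift (*) G (\<psi> (id_mult scaleC scaleA ?X))"
    by (simp add: alg.id_mult_ten3)
  also have "\<dots> = lift (*) H (id_tensor scaleA scaleC scaleA scaleA scaleC \<psi>
          (tensor_id scaleC scaleA scaleA scaleC scaleA \<psi> ?X))"
    unfolding psi_mult[OF ten3_in_tensor3] mult_id_def lift_qlift[OF vs subspace_rel2 vanishes_on_rel2[OF G]]
    by (simp add: H_def lift_ten2[OF G] case_prod_unfold)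
  also have "\<dots> = lift (*) K (tensor_id scaleC scaleA scaleA scaleC scaleA \<psi> ?X)"
    unfolding id_tensor_def lift_qlift[OF vs subspace_rel3 vanishes_on_rel3[OF H]]
    by (simp add: K_def case_prod_unfold lift_qlift[OF vs subspace_rel3 vanishes_on_rel3[OF H]] lift_ten3[OF H])
  also have "\<dots> = lift (*) J ?X"
    unfolding tensor_id_def lift_qlift[OF vs subspace_rel3 vanishes_on_rel3[OF K]]
    by (simp add: J_def case_prod_unfold lift_qlift[OF vs subspace_rel3 vanishes_on_rel3[OF K]] lift_ten3[OF K])
  also have "\<dots> = J (c, a, b)" by (rule lift_ten3[OF J])
  finally show ?thesis by (simp add: J_def K_def H_def)
qed

lemma multilinear_last:
  assumes "multilinear scaleA scaleC (length as + 1) F"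
  shows "bilinear2 scaleA scaleC (\<lambda>(a', c'). F c' (as @ [a']))"
proof -
  have "Vector_Spaces.linear scaleA (*) (\<lambda>a. F c ((as @ [undefined])[length as := a]))" for c
    using assms unfolding multilinear_def by (metis length_append_singleton less_add_one Suc_eq_plus1)
  then show ?thesis using assms by (simp add: bilinear2_def multilinear_def)
qed

lemma multilinear_cyc:
  assumes F: "multilinear scaleA scaleC (m + 1) F"
  shows "multilinear scaleA scaleC (m + 1) (cyc F)"
  unfolding multilinear_def
proof (intro conjI allI impI)
  fix as :: "'a list" assume as: "length as = m + 1"
  then have B: "bilinear2 scaleA scaleC (\<lambda>(a', c'). F c' (tl as @ [a']))"
    using F by (intro multilinear_last) simp
  show "Vector_Spaces.linear scaleC (*) (\<lambda>c. cyc F c as)"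
    unfolding cyc_def by (rule linear_lift_psi[OF B])
  fix c j assume j: "j < m + 1"
  show "Vector_Spaces.linear scaleA (*) (\<lambda>a. cyc F c (as[j := a]))"
  proof (cases j)
    case 0
    then show ?thesis
      using as linear_lift_psi(2)[OF B] by (cases as) (auto simp: cyc_def)
  next
    case (Suc i)
    \<comment> \<open>Every entry but the first only moves one position to the left.\<close>
    have "Vector_Spaces.linear scaleA (*) (\<lambda>a. F c' ((tl as @ [a'])[i := a]))" for c' a'
      using F as j Suc by (auto simp: multilinear_def)
    then have "Vector_Spaces.linear scaleA (*) (\<lambda>a. F c' ((tl as)[i := a] @ [a']))" for c' a'
      using as j Suc by (simp add: list_update_append)
    then show ?thesis
      using as Suc by (cases as) (auto simp: cyc_def intro!: linear_lift_pointwise)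
  qed
qed

lemma multilinear_face:
  assumes F: "multilinear scaleA scaleC m F" and i: "i < m"
  shows "multilinear scaleA scaleC (m + 1) (face i F)"
  unfolding multilinear_def
proof (intro conjI allI impI)
  fix as :: "'a list" assume as: "length as = m + 1"
  show "Vector_Spaces.linear scaleC (*) (\<lambda>c. face i F c as)"
    using F as i by (simp add: multilinear_def face_def length_merge)
  fix c j assume j: "j < m + 1"
  have lin: "Vector_Spaces.linear scaleA (*) (\<lambda>a. F c ((merge i as)[l := a]))" if "l < m" for l
    using F as i that by (simp add: multilinear_def length_merge)
  note lin' = Vector_Spaces.linear_compose[OF alg.linear_mult(1) lin[OF i], unfolded o_def]
    Vector_Spaces.linear_compose[OF alg.linear_mult(2) lin[OF i], unfolded o_def]
  show "Vector_Spaces.linear scaleA (*) (\<lambda>a. face i F c (as[j := a]))"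
    unfolding face_def merge_update[OF as i j]
    by (cases "j < i"; cases "j = i"; cases "j = i + 1") (use i j lin lin' in simp_all)
qed

lemma cyc_face:
  assumes "length as = m + 1" "i + 1 < m"
  shows "cyc (face i F) c as = face (i + 1) (cyc F) c as"
  using assms
  by (cases as) (simp_all add: cyc_def face_def merge_rotate, simp add: merge_def)

text \<open>
  After two rotations the first two entries have become the last two, and \<open>face m\<close> multiplies them.
\<close>

lemma cyc_cyc_last_face:
  assumes F: "multilinear scaleA scaleC (m + 1) F" and as: "length as = m + 2"
  shows "cyc (cyc (face m F)) c as = face 0 (cyc F) c as"
proof -
  obtain a b bs where [simp]: "as = a # b # bs" and [simp]: "length bs = m"
    using as by (metis add_2_eq_Suc' length_Suc_conv)
  have "bilinear2 scaleA scaleC (\<lambda>(a', c'). F c' (bs @ [a']))"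
    using multilinear_last[of bs] F by simp
  from lift_psi_mult[OF this, of b c a] show ?thesis
    by (simp add: cyc_def face_def merge_def nth_append)
qed

lemma cyc_add: "cyc (\<lambda>c as. F c as + G c as) c as = cyc F c as + cyc G c as"
  by (simp add: cyc_def lift_def case_prod_unfold distrib_left sum.distrib)

lemma cyc_scale: "cyc (\<lambda>c as. r * F c as) c as = r * cyc F c as"
  by (simp add: cyc_def lift_def case_prod_unfold sum_distrib_left ac_simps)

lemma cyc_sum: "cyc (\<lambda>c as. \<Sum>i\<in>I. F i c as) c as = (\<Sum>i\<in>I. cyc (F i) c as)"
  unfolding cyc_def lift_def
  by (simp add: case_prod_unfold sum_distrib_left) (rule sum.swap)

text \<open>
  A rotation preserves the length of a nonempty list, but lengthens the empty one.
\<close>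

lemma cyc_cong:
  assumes "\<And>c as. length as = m \<Longrightarrow> F c as = G c as" "length as = m" "m > 0"
  shows "cyc F c as = cyc G c as"
proof -
  have "(\<lambda>(a', c'). F c' (tl as @ [a'])) = (\<lambda>(a', c'). G c' (tl as @ [a']))"
    using assms by auto
  then show ?thesis by (simp add: cyc_def)
qed

section \<open>The differential\<close>

text \<open>
  The wrap-around term of the differential is written with the rotation, so that its behaviour under
  a further rotation follows from the relations between \<open>cyc\<close> and \<open>face\<close>.
\<close>

definition coboundary :: "nat \<Rightarrow> ('c \<Rightarrow> 'a list \<Rightarrow> 'k) \<Rightarrow> 'c \<Rightarrow> 'a list \<Rightarrow> 'k" where
  "coboundary n F c as = cyc (face n F) c as + (\<Sum>i\<le>n. (- 1) ^ (i + 1) * face i F c as)"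

lemma multilinear_coboundary:
  assumes F: "multilinear scaleA scaleC (n + 1) F"
  shows "multilinear scaleA scaleC (n + 2) (coboundary n F)"
proof -
  interpret CP: vector_space_pair scaleC "(*)"
    by (intro vector_space_pair.intro coalg.vector_space_axioms vector_space_mult)
  interpret AP: vector_space_pair scaleA "(*)"
    by (intro vector_space_pair.intro alg.vector_space_axioms vector_space_mult)
  have f: "multilinear scaleA scaleC (n + 2) (face i F)" if "i \<le> n" for i
    using multilinear_face[OF F, of i] that by simp
  have t: "multilinear scaleA scaleC (n + 2) (cyc (face n F))"
    using multilinear_cyc[of "n + 1"] f[of n] by simp
  show ?thesis
    unfolding multilinear_def coboundary_def
  proof (intro conjI allI impI)
    fix as :: "'a list" assume "length as = n + 2"
    then show "Vector_Spaces.linear scaleC (*)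
        (\<lambda>c. cyc (face n F) c as + (\<Sum>i\<le>n. (- 1) ^ (i + 1) * face i F c as))"
      by (intro CP.linear_compose_add CP.linear_compose_sum CP.linear_compose_scale_right ballI)
         (use f t in \<open>simp_all add: multilinear_def\<close>)
    fix c j assume "j < n + 2"
    with \<open>length as = n + 2\<close> show "Vector_Spaces.linear scaleA (*)
        (\<lambda>a. cyc (face n F) c (as[j := a]) + (\<Sum>i\<le>n. (- 1) ^ (i + 1) * face i F c (as[j := a])))"
      by (intro AP.linear_compose_add AP.linear_compose_sum AP.linear_compose_scale_right ballI)
         (use f t in \<open>simp_all add: multilinear_def\<close>)
  qed
qed

text \<open>
  Apply the rotation to each term of the differential. The relations return the other terms with one
  index shift, and cyclicity of \<open>F\<close> removes the rotation from the faces; all signs agree.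
\<close>

lemma cyclic_coboundary:
  assumes F: "multilinear scaleA scaleC (n + 1) F"
    and cyclic: "\<And>c as. length as = n + 1 \<Longrightarrow> F c as = (- 1) ^ n * cyc F c as"
    and as: "length as = n + 2"
  shows "coboundary n F c as = (- 1) ^ (n + 1) * cyc (coboundary n F) c as"
proof -
  have cyc_F: "face i (cyc F) c as = (- 1) ^ n * face i F c as" if "i \<le> n" for i
    using cyclic[of "merge i as" c] that as length_merge[of as "n + 1" i]
    by (simp add: face_def flip: mult.assoc power_mult_distrib)
  have "cyc (coboundary n F) c as = cyc (cyc (face n F)) c as
      + (\<Sum>i\<le>n. (- 1) ^ (i + 1) * cyc (face i F) c as)"
    unfolding coboundary_def by (simp only: cyc_add cyc_sum cyc_scale)
  also have "(\<Sum>i\<le>n. (- 1) ^ (i + 1) * cyc (face i F) c as) =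
      (\<Sum>i<n. (- 1) ^ (i + 1) * cyc (face i F) c as) + (- 1) ^ (n + 1) * cyc (face n F) c as"
    by (simp flip: lessThan_Suc_atMost)
  also have "(\<Sum>i<n. (- 1) ^ (i + 1) * cyc (face i F) c as) =
      - ((- 1) ^ n * (\<Sum>i<n. (- 1) ^ i * face (i + 1) F c as))"
    using as by (simp add: cyc_face[of as "n + 1"] cyc_F sum_distrib_left ac_simps flip: sum_negf)
  also have "cyc (cyc (face n F)) c as = (- 1) ^ n * face 0 F c as"
    by (simp add: cyc_cyc_last_face[OF F as] cyc_F)
  finally have "cyc (coboundary n F) c as = (- 1) ^ n * (face 0 F c as
      - (\<Sum>i<n. (- 1) ^ i * face (i + 1) F c as) - cyc (face n F) c as)"
    by (simp add: right_diff_distrib)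
  then have "(- 1) ^ (n + 1) * cyc (coboundary n F) c as =
      - face 0 F c as + (\<Sum>i<n. (- 1) ^ (i + 2) * face (i + 1) F c as) + cyc (face n F) c as"
    by (simp flip: mult.assoc power_mult_distrib)
  also have "\<dots> = coboundary n F c as"
    unfolding coboundary_def by (simp add: sum.atMost_shift)
  finally show ?thesis by simp
qed

section \<open>Cochains as multilinear functions\<close>

abbreviation pure :: "(('c \<times> 'a list \<Rightarrow>\<^sub>0 'k) set \<Rightarrow> 'k) \<Rightarrow> 'c \<Rightarrow> 'a list \<Rightarrow> 'k" where
  "pure g c as \<equiv> g (hten scaleA scaleC c as)"

lemma hten_in_hoch_tensor: "length as = m \<Longrightarrow> hten scaleA scaleC c as \<in> hoch_tensor scaleA scaleC m"
  by (auto simp: hten_def hoch_tensor_def quot_def gen_def)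

lemma slot_rels_hoch_rel:
  "length as = m \<Longrightarrow> slot_rels scaleC (\<lambda>c. (c, as)) \<subseteq> hoch_rel scaleA scaleC m"
  "length as = m \<Longrightarrow> j < m \<Longrightarrow> slot_rels scaleA (\<lambda>a. (c, as[j := a])) \<subseteq> hoch_rel scaleA scaleC m"
  unfolding hoch_rel_def by (auto 0 4 intro!: free.span_base)

lemma multilinear_pure:
  assumes "g \<in> hoch_cochains scaleA scaleC n"
  shows "multilinear scaleA scaleC (n + 1) (pure g)"
proof -
  let ?N = "hoch_rel scaleA scaleC (n + 1)"
  have g: "X \<in> hoch_tensor scaleA scaleC (n + 1) \<Longrightarrow> Y \<in> hoch_tensor scaleA scaleC (n + 1) \<Longrightarrow>
      g (qadd ?N X Y) = g X + g Y"
    "X \<in> hoch_tensor scaleA scaleC (n + 1) \<Longrightarrow> g (qscale ?N r X) = r * g X" for X Y r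
    using assms by (auto simp: hoch_cochains_def)
  have mem: "coset ?N (gen (c, as)) \<in> hoch_tensor scaleA scaleC (n + 1)" if "length as = n + 1" for c as
    using hten_in_hoch_tensor[OF that] that by (simp add: hten_def)
  show ?thesis
    unfolding multilinear_def
  proof (intro conjI allI impI)
    fix as :: "'a list" assume as: "length as = n + 1"
    note r = qadd_slot[OF subspace_hoch_rel slot_rels_hoch_rel(1)[OF as]]
      qscale_slot[OF subspace_hoch_rel slot_rels_hoch_rel(1)[OF as]]
    show "Vector_Spaces.linear scaleC (*) (\<lambda>c. pure g c as)"
      unfolding hten_def as Vector_Spaces.linear_iff
      by (intro conjI allI coalg.vector_space_axioms vector_space_mult) (simp_all only: r g mem as)
    fix c j assume j: "j < n + 1"
    note r = qadd_slot[OF subspace_hoch_rel slot_rels_hoch_rel(2)[OF as j]]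
      qscale_slot[OF subspace_hoch_rel slot_rels_hoch_rel(2)[OF as j]]
    show "Vector_Spaces.linear scaleA (*) (\<lambda>a. pure g c (as[j := a]))"
      unfolding hten_def length_list_update as Vector_Spaces.linear_iff
      by (intro conjI allI alg.vector_space_axioms vector_space_mult) (simp_all only: r g mem as length_list_update)
  qed
qed

lemma vanishes_on_hoch_rel:
  "multilinear scaleA scaleC m F \<Longrightarrow> vanishes_on (*) (\<lambda>(c, as). F c as) (hoch_rel scaleA scaleC m)"
  unfolding hoch_rel_def multilinear_def
  by (intro vanishes_on_span vector_space_mult) (auto elim!: linext_slot_rels[rotated])

text \<open>
  Since the relations only involve lists of length \<open>m\<close>, the representative chosen from an element of
  \<open>C \<otimes> A\<^sup>\<otimes>\<^sup>m\<close> does so too. The formula for the differential makes sense only on such lists.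
\<close>

lemma keys_hoch_rel:
  assumes "p \<in> hoch_rel scaleA scaleC m"
  shows "Poly_Mapping.keys p \<subseteq> {(c, as). length as = m}"
proof -
  let ?S = "{(c, as). length as = m} :: ('c \<times> 'a list) set"
  have sub: "subspace {p :: 'c \<times> 'a list \<Rightarrow>\<^sub>0 'k. Poly_Mapping.keys p \<subseteq> ?S}"
    by (auto simp: free.subspace_def
        dest!: subsetD[OF Poly_Mapping.keys_add] subsetD[OF keys_fscale])
  have "hoch_rel scaleA scaleC m \<subseteq> {p. Poly_Mapping.keys p \<subseteq> ?S}"
    unfolding hoch_rel_def
    by (rule free.span_minimal[OF _ sub], safe; drule keys_slot_rels, force)
  then show ?thesis using assms by auto
qed

lemma keys_rep_hoch_tensor:
  assumes "X \<in> hoch_tensor scaleA scaleC m"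
  shows "Poly_Mapping.keys (rep X) \<subseteq> {(c, as). length as = m}"
proof -
  obtain p where X: "X = coset (hoch_rel scaleA scaleC m) p"
    and p: "Poly_Mapping.keys p \<subseteq> {(c, as). length as = m}"
    using assms by (auto simp: hoch_tensor_def quot_def)
  have "Poly_Mapping.keys (rep X - p) \<subseteq> {(c, as). length as = m}"
    unfolding X by (intro keys_hoch_rel rep_coset subspace_hoch_rel)
  moreover have "Poly_Mapping.keys (rep X) \<subseteq> Poly_Mapping.keys (rep X - p) \<union> Poly_Mapping.keys p"
    using Poly_Mapping.keys_add[of "rep X - p" p] by simp
  ultimately show ?thesis using p by blast
qed

lemma hoch_tensor_closed:
  assumes "X \<in> hoch_tensor scaleA scaleC m"
  shows "Y \<in> hoch_tensor scaleA scaleC m \<Longrightarrow>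
      qadd (hoch_rel scaleA scaleC m) X Y \<in> hoch_tensor scaleA scaleC m"
    and "qscale (hoch_rel scaleA scaleC m) r X \<in> hoch_tensor scaleA scaleC m"
  using keys_rep_hoch_tensor[OF assms] keys_rep_hoch_tensor[of Y m]
    order_trans[OF Poly_Mapping.keys_add[of "rep X" "rep Y"]] order_trans[OF keys_fscale[of r "rep X"]]
  unfolding qadd_def qscale_def hoch_tensor_def quot_def by (blast intro!: imageI)+

lemma hoch_diff_pure_eq:
  assumes "length as = n + 2"
  shows "hoch_diff_pure scaleA scaleC \<psi> n g c as = coboundary n (pure g) c as"
proof -
  obtain a bs b where as: "as = a # bs @ [b]" and bs: "length bs = n"
    using assms by (metis add_2_eq_Suc' length_Suc_conv length_append_singleton rev_exhaust
        length_0_conv nat.simps(3) old.nat.inject)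
  have "(\<Sum>i=1..n+1. (- 1) ^ i * pure g c (take (i - 1) as @ [as ! (i - 1) * as ! i] @ drop (i + 1) as))
      = (\<Sum>i\<le>n. (- 1) ^ (i + 1) * face i (pure g) c as)"
    by (rule sum.reindex_bij_witness[of _ "\<lambda>i. i + 1" "\<lambda>i. i - 1"])
       (auto simp: face_def merge_def)
  moreover have "merge n (tl as @ [x]) = butlast (tl as) @ [last as * x]" for x
    using as bs by (simp add: merge_def nth_append)
  ultimately show ?thesis
    by (simp add: hoch_diff_pure_def coboundary_def cyc_def face_def)
qed

lemma hoch_diff_eq:
  assumes "X \<in> hoch_tensor scaleA scaleC (n + 2)"
  shows "hoch_diff scaleA scaleC \<psi> n g X = lift (*) (\<lambda>(c, as). coboundary n (pure g) c as) X"
  using keys_rep_hoch_tensor[OF assms] assms unfolding hoch_diff_def lift_def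
  by (auto intro!: sum.cong simp: hoch_diff_pure_eq)

lemma
  assumes "g \<in> hoch_cochains scaleA scaleC n"
  shows hoch_diff_in_cochains:
      "hoch_diff scaleA scaleC \<psi> n g \<in> hoch_cochains scaleA scaleC (n + 1)"
    and hoch_diff_hten: "length as = n + 2 \<Longrightarrow>
      hoch_diff scaleA scaleC \<psi> n g (hten scaleA scaleC c as) = coboundary n (pure g) c as"
proof -
  note k = vector_space_mult subspace_hoch_rel
    vanishes_on_hoch_rel[OF multilinear_coboundary[OF multilinear_pure[OF assms]]]
  show "hoch_diff scaleA scaleC \<psi> n g \<in> hoch_cochains scaleA scaleC (n + 1)"
    using lift_qadd[OF k] lift_qscale[OF k]
    by (simp add: hoch_cochains_def hoch_diff_eq hoch_tensor_closed) (simp add: hoch_diff_def)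
  show "hoch_diff scaleA scaleC \<psi> n g (hten scaleA scaleC c as) = coboundary n (pure g) c as"
    if "length as = n + 2"
    using lift_coset[OF k, of "gen (c, as)"] that
    by (simp add: hoch_diff_eq hten_in_hoch_tensor)
       (simp add: hten_def linext_gen[OF vector_space_mult])
qed

lemma cyclic_cochains_iff:
  "g \<in> cyclic_cochains scaleA scaleC \<psi> n \<longleftrightarrow> g \<in> hoch_cochains scaleA scaleC n \<and>
     (\<forall>c as. length as = n + 1 \<longrightarrow> pure g c as = (- 1) ^ n * cyc (pure g) c as)"
  by (simp add: cyclic_cochains_def cyc_def)

lemma hoch_diff_cyclic:
  assumes "g \<in> cyclic_cochains scaleA scaleC \<psi> n"
  shows "hoch_diff scaleA scaleC \<psi> n g \<in> cyclic_cochains scaleA scaleC \<psi> (n + 1)"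
  unfolding cyclic_cochains_iff
proof (intro conjI allI impI)
  have g: "g \<in> hoch_cochains scaleA scaleC n"
    and cyclic: "\<And>c as. length as = n + 1 \<Longrightarrow> pure g c as = (- 1) ^ n * cyc (pure g) c as"
    using assms by (auto simp: cyclic_cochains_iff)
  show "hoch_diff scaleA scaleC \<psi> n g \<in> hoch_cochains scaleA scaleC (n + 1)"
    by (rule hoch_diff_in_cochains[OF g])
  fix c and as :: "'a list" assume "length as = n + 1 + 1"
  then have as: "length as = n + 2" by simp
  have "cyc (pure (hoch_diff scaleA scaleC \<psi> n g)) c as = cyc (coboundary n (pure g)) c as"
    by (rule cyc_cong[OF _ as]) (simp_all add: hoch_diff_hten[OF g])
  then show "pure (hoch_diff scaleA scaleC \<psi> n g) c as =
      (- 1) ^ (n + 1) * cyc (pure (hoch_diff scaleA scaleC \<psi> n g)) c as"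
    using cyclic_coboundary[OF multilinear_pure[OF g] cyclic as]
    by (simp add: hoch_diff_hten[OF g as])
qed

lemma subspace_cyclic_cochains:
  "module.subspace fun_scale (cyclic_cochains scaleA scaleC \<psi> n)"
proof -
  interpret funs: module "fun_scale :: 'k \<Rightarrow> (('c \<times> 'a list \<Rightarrow>\<^sub>0 'k) set \<Rightarrow> 'k) \<Rightarrow> _"
    by unfold_locales (auto simp: fun_scale_def plus_fun_def algebra_simps)
  let ?Z = "cyclic_cochains scaleA scaleC \<psi> n"
  show ?thesis
  proof (rule funs.subspaceI)
    show "0 \<in> ?Z"
      by (simp add: cyclic_cochains_iff hoch_cochains_def cyc_def lift_def case_prod_unfold)
    show "f + g \<in> ?Z" if "f \<in> ?Z" "g \<in> ?Z" for f g
      using that by (simp add: cyclic_cochains_iff hoch_cochains_def cyc_add algebra_simps)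
    show "fun_scale r g \<in> ?Z" if "g \<in> ?Z" for r g
      using that by (simp add: cyclic_cochains_iff hoch_cochains_def fun_scale_def cyc_scale algebra_simps)
  qed
qed

end

theorem theorem2p2:
  fixes scaleA :: "'k::field \<Rightarrow> 'a \<Rightarrow> 'a::{ring, monoid_mult}"
    and scaleC :: "'k \<Rightarrow> 'c \<Rightarrow> 'c::ab_group_add"
    and \<Delta> :: "'c \<Rightarrow> ('c \<times> 'c \<Rightarrow>\<^sub>0 'k) set"
    and \<epsilon> :: "'c \<Rightarrow> 'k"
    and \<psi> :: "('c \<times> 'a \<Rightarrow>\<^sub>0 'k) set \<Rightarrow> ('a \<times> 'c \<Rightarrow>\<^sub>0 'k) set"
  assumes "entwining_structure scaleA scaleC \<Delta> \<epsilon> \<psi>"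
  shows "\<forall>n. module.subspace fun_scale (cyclic_cochains scaleA scaleC \<psi> n) \<and>
           cyclic_cochains scaleA scaleC \<psi> n \<subseteq> hoch_cochains scaleA scaleC n \<and>
           hoch_diff scaleA scaleC \<psi> n ` cyclic_cochains scaleA scaleC \<psi> n
             \<subseteq> cyclic_cochains scaleA scaleC \<psi> (n + 1)"
proof -
  interpret entwining_structure scaleA scaleC \<Delta> \<epsilon> \<psi> by fact
  show ?thesis
    using subspace_cyclic_cochains hoch_diff_cyclic by (auto simp: cyclic_cochains_iff)
qed

end
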